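(* For every integer $k>1$ there is a solution $w(x,t)$ of the mean curvature flow of graphs on $\mathbb{R}\times[0,\infty)$ with $$2k<\|w(\cdot,0)\|_\infty\le 3k$$ and $$4k^2-2k\le\int_{-\pi}^{\pi}\bigl(1+|dw(x,1)|^2\bigr)^{1/2}\,dx .$$
   Context: Here the spatial dimension is $n=1$. A solution $w:\mathbb{R}\times[0,\infty)\to\mathbb{R}$ of the mean curvature flow of graphs is a smooth function whose graph flows by mean curvature, i.e. $w_t=(1+|dw|^2)^{1/2}\,\frac{d}{dx}\left(\frac{w_x}{(1+|dw|^2)^{1/2}}\right)$, equivalently $w_t=\frac{w_{xx}}{1+w_x^2}$. $dw=w_x$ denotes the derivative in the spatial variable $x$, and $\|\cdot\|_\infty$ is the sup norm (over $x\in\mathbb{R}$). *)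

theory Defs
  imports "HOL-Analysis.Analysis"
begin

text \<open>
  Derivatives are taken within \<open>S\<close>, so on the closed half-plane \<open>UNIV \<times> {0..}\<close> they are one-sided
  in time at the boundary \<open>t = 0\<close>. There \<open>fx\<close> and \<open>ft\<close> are the (uniquely determined)
  partial derivatives.
\<close>

primrec Ck_on :: "nat \<Rightarrow> (real \<times> real) set \<Rightarrow> (real \<times> real \<Rightarrow> real) \<Rightarrow> bool" where
  "Ck_on 0 S f \<longleftrightarrow> continuous_on S f"
| "Ck_on (Suc m) S f \<longleftrightarrow>
     (\<exists>fx ft. (\<forall>p\<in>S. (f has_derivative (\<lambda>h. fx p * fst h + ft p * snd h)) (at p within S)) \<and>
              Ck_on m S fx \<and> Ck_on m S ft)"

definition smooth_on :: "(real \<times> real) set \<Rightarrow> (real \<times> real \<Rightarrow> real) \<Rightarrow> bool" where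
  "smooth_on S f \<longleftrightarrow> (\<forall>m. Ck_on m S f)"

definition dx :: "(real \<Rightarrow> real \<Rightarrow> real) \<Rightarrow> real \<Rightarrow> real \<Rightarrow> real" where
  "dx w x t = deriv (\<lambda>y. w y t) x"

definition graph_mcf_solution :: "(real \<Rightarrow> real \<Rightarrow> real) \<Rightarrow> bool" where
  "graph_mcf_solution w \<longleftrightarrow>
     smooth_on (UNIV \<times> {0..}) (\<lambda>(x, t). w x t) \<and>
     (\<forall>x. \<forall>t\<ge>0.
        ((\<lambda>s. w x s) has_real_derivative
           sqrt (1 + \<bar>dx w x t\<bar>\<^sup>2) *
           deriv (\<lambda>y. dx w y t / sqrt (1 + \<bar>dx w y t\<bar>\<^sup>2)) x)
        (at t within {0..}))"

text \<open>Extended-real valued, so that an unbounded function has norm \<open>\<infinity>\<close>.\<close>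

definition sup_norm :: "(real \<Rightarrow> real) \<Rightarrow> ereal" where
  "sup_norm f = (SUP x. ereal \<bar>f x\<bar>)"

end

theory Submission
  imports Defs
begin

text \<open>
  The solution is explicit. Rescaling the ``hairclip'' solution \<open>sinh w = exp (- t) * cos x\<close> gives
  \<open>w x t = arsinh (C * exp (- \<kappa>\<^sup>2 * t) * cos (\<kappa> * x)) / \<kappa>\<close>, which looks like alternating grim reapers
  in strips of width \<open>\<pi> / \<kappa>\<close>, moving with speed about \<open>\<kappa>\<close>. With \<open>\<kappa> = k\<close> and \<open>C = sinh (3 * k\<^sup>2)\<close> the
  amplitude is \<open>3 * k\<close> at time \<open>0\<close> and still at least \<open>k\<close> at time \<open>1\<close>. The graph over
  \<open>[- \<pi>, \<pi>]\<close> then goes \<open>2 * k\<close> times from top to bottom or back, so its length is at least \<open>4 * k\<^sup>2\<close>.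
\<close>

text \<open>Induction on \<open>m\<close> with \<open>f\<close> arbitrary: partial derivatives stay
  in the class \<open>F\<close>, and differentiability alone gives the continuity required at
  \<open>m = 0\<close>. Smoothness is thus reduced to finding a class closed under partial
  derivatives.\<close>

lemma Ck_on_derivative_closed:
  assumes closed: "\<And>f. F f \<Longrightarrow> \<exists>fx ft. F fx \<and> F ft \<and>
      (\<forall>p\<in>S. (f has_derivative (\<lambda>h. fx p * fst h + ft p * snd h)) (at p within S))"
    and "F f"
  shows "Ck_on m S f"
  using \<open>F f\<close>
proof (induction m arbitrary: f)
  case 0
  then obtain fx ft where
    "\<forall>p\<in>S. (f has_derivative (\<lambda>h. fx p * fst h + ft p * snd h)) (at p within S)"
    using closed by blast
  then show ?case
    by (auto simp: continuous_on_eq_continuous_within intro: has_derivative_continuous)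
next
  case (Suc m)
  then show ?case
    using closed[OF Suc.prems] by auto
qed

section \<open>The explicit solution and its smoothness\<close>

text \<open>A decaying Fourier mode of the heat equation. Up to constant factors, it and
  \<open>hc_sin\<close> are each other's derivative in \<open>x\<close>, and each is its own
  derivative in \<open>t\<close>.\<close>

definition hc_cos :: "real \<Rightarrow> real \<Rightarrow> real \<Rightarrow> real \<Rightarrow> real" where
  "hc_cos \<kappa> C x t = C * exp (- \<kappa>\<^sup>2 * t) * cos (\<kappa> * x)"

definition hc_sin :: "real \<Rightarrow> real \<Rightarrow> real \<Rightarrow> real \<Rightarrow> real" where
  "hc_sin \<kappa> C x t = C * exp (- \<kappa>\<^sup>2 * t) * sin (\<kappa> * x)"

definition hairclip :: "real \<Rightarrow> real \<Rightarrow> real \<Rightarrow> real \<Rightarrow> real" where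
  "hairclip \<kappa> C x t = arsinh (hc_cos \<kappa> C x t) / \<kappa>"

lemma has_derivative_pair_hc_cos:
  "((\<lambda>p. hc_cos \<kappa> C (fst p) (snd p)) has_derivative
     (\<lambda>h. - \<kappa> * hc_sin \<kappa> C (fst p) (snd p) * fst h + - \<kappa>\<^sup>2 * hc_cos \<kappa> C (fst p) (snd p) * snd h))
   (at p within S)"
  unfolding hc_cos_def hc_sin_def
  by (auto intro!: derivative_eq_intros simp: fun_eq_iff algebra_simps)

lemma has_derivative_pair_hc_sin:
  "((\<lambda>p. hc_sin \<kappa> C (fst p) (snd p)) has_derivative
     (\<lambda>h. \<kappa> * hc_cos \<kappa> C (fst p) (snd p) * fst h + - \<kappa>\<^sup>2 * hc_sin \<kappa> C (fst p) (snd p) * snd h))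
   (at p within S)"
  unfolding hc_cos_def hc_sin_def
  by (auto intro!: derivative_eq_intros simp: fun_eq_iff algebra_simps)

lemma sqrt_one_plus_square_pos: "0 < sqrt (1 + (x::real)\<^sup>2)"
  by (simp add: add_pos_nonneg)

text \<open>The cube is kept as a power of \<open>1 / sqrt (1 + x\<^sup>2)\<close> so that the
  derivative is visibly a polynomial in \<open>x\<close> and the function itself.\<close>

lemma DERIV_inverse_sqrt_one_plus_square:
  "((\<lambda>x::real. 1 / sqrt (1 + x\<^sup>2)) has_real_derivative - x * (1 / sqrt (1 + x\<^sup>2)) ^ 3) (at x)"
proof -
  have s: "sqrt (1 + x\<^sup>2) \<noteq> 0"
    using sqrt_one_plus_square_pos[of x] by simp
  have "((\<lambda>x. sqrt (1 + x\<^sup>2)) has_real_derivative x / sqrt (1 + x\<^sup>2)) (at x)"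
    using add_pos_nonneg[OF zero_less_one zero_le_power2[of x]]
    by (auto intro!: derivative_eq_intros simp: field_simps)
  from DERIV_inverse_fun[OF this s] show ?thesis
    by (rule DERIV_cong_ev[THEN iffD1, OF refl _ _, rotated -1])
       (use s in \<open>simp_all add: divide_simps power3_eq_cube\<close>)
qed

lemma has_derivative_pair_inverse_sqrt_hc_cos:
  fixes \<kappa> C :: real
  defines "u \<equiv> \<lambda>p. hc_cos \<kappa> C (fst p) (snd p)" and "v \<equiv> \<lambda>p. hc_sin \<kappa> C (fst p) (snd p)"
  defines "s \<equiv> \<lambda>p. 1 / sqrt (1 + (u p)\<^sup>2)"
  shows "(s has_derivative (\<lambda>h. \<kappa> * (u p * v p * s p ^ 3) * fst h + \<kappa>\<^sup>2 * ((u p)\<^sup>2 * s p ^ 3) * snd h))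
    (at p within S)"
proof -
  have "((\<lambda>q. (\<lambda>x. 1 / sqrt (1 + x\<^sup>2)) (u q)) has_derivative
      (\<lambda>h. (- \<kappa> * v p * fst h + - \<kappa>\<^sup>2 * u p * snd h) * (- u p * s p ^ 3))) (at p within S)"
    unfolding s_def
    unfolding u_def v_def
    by (rule DERIV_compose_FDERIV[OF DERIV_inverse_sqrt_one_plus_square has_derivative_pair_hc_cos])
  then show ?thesis
    unfolding s_def
    by (rule has_derivative_eq_rhs) (auto simp: fun_eq_iff algebra_simps power2_eq_square)
qed

text \<open>Polynomials in \<open>u = hc_cos\<close>, \<open>v = hc_sin\<close> and \<open>1 / sqrt (1 + u\<^sup>2)\<close>: this ring contains the partial
  derivatives of the solution and is closed under differentiation.\<close>

inductive hc_ring :: "real \<Rightarrow> real \<Rightarrow> (real \<times> real \<Rightarrow> real) \<Rightarrow> bool" for \<kappa> C where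
  hc_ring_const: "hc_ring \<kappa> C (\<lambda>p. c)"
| hc_ring_cos: "hc_ring \<kappa> C (\<lambda>p. hc_cos \<kappa> C (fst p) (snd p))"
| hc_ring_sin: "hc_ring \<kappa> C (\<lambda>p. hc_sin \<kappa> C (fst p) (snd p))"
| hc_ring_sqrt: "hc_ring \<kappa> C (\<lambda>p. 1 / sqrt (1 + (hc_cos \<kappa> C (fst p) (snd p))\<^sup>2))"
| hc_ring_add: "hc_ring \<kappa> C f \<Longrightarrow> hc_ring \<kappa> C g \<Longrightarrow> hc_ring \<kappa> C (\<lambda>p. f p + g p)"
| hc_ring_mult: "hc_ring \<kappa> C f \<Longrightarrow> hc_ring \<kappa> C g \<Longrightarrow> hc_ring \<kappa> C (\<lambda>p. f p * g p)"

lemma hc_ring_power: "hc_ring \<kappa> C f \<Longrightarrow> hc_ring \<kappa> C (\<lambda>p. f p ^ n)"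
  by (induction n) (auto intro: hc_ring_const hc_ring_mult)

lemma hc_ring_derivative_closed:
  assumes "hc_ring \<kappa> C f"
  shows "\<exists>fx ft. hc_ring \<kappa> C fx \<and> hc_ring \<kappa> C ft \<and>
    (\<forall>p\<in>S. (f has_derivative (\<lambda>h. fx p * fst h + ft p * snd h)) (at p within S))"
  using assms
proof induction
  case (hc_ring_const c)
  have "((\<lambda>p. c) has_derivative (\<lambda>h. 0 * fst h + 0 * snd h)) (at p within S)" for p :: "real \<times> real"
    by simp
  then show ?case
    using hc_ring.hc_ring_const by blast
next
  case hc_ring_cos
  show ?case
    \<comment> \<open>Solving the third goal first instantiates the schematic partial derivatives;
      their membership in the ring then follows from their syntactic form.\<close>
    by (intro exI conjI ballI, rule_tac[3] has_derivative_pair_hc_cos)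
       (intro hc_ring.intros)+
next
  case hc_ring_sin
  show ?case
    by (intro exI conjI ballI, rule_tac[3] has_derivative_pair_hc_sin)
       (intro hc_ring.intros)+
next
  case hc_ring_sqrt
  show ?case
    by (intro exI conjI ballI, rule_tac[3] has_derivative_pair_inverse_sqrt_hc_cos)
       (intro hc_ring.intros hc_ring_power)+
next
  case (hc_ring_add f g)
  then obtain fx ft gx gt where *: "hc_ring \<kappa> C fx" "hc_ring \<kappa> C ft" "hc_ring \<kappa> C gx" "hc_ring \<kappa> C gt"
    "\<And>p. p \<in> S \<Longrightarrow> (f has_derivative (\<lambda>h. fx p * fst h + ft p * snd h)) (at p within S)"
    "\<And>p. p \<in> S \<Longrightarrow> (g has_derivative (\<lambda>h. gx p * fst h + gt p * snd h)) (at p within S)"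
    by blast
  have "((\<lambda>p. f p + g p) has_derivative (\<lambda>h. (fx p + gx p) * fst h + (ft p + gt p) * snd h))
      (at p within S)" if "p \<in> S" for p
    by (rule has_derivative_eq_rhs[OF has_derivative_add[OF *(5,6)[OF that]]])
       (auto simp: fun_eq_iff algebra_simps)
  with *(1-4) show ?case
    by (intro exI[of _ "\<lambda>p. fx p + gx p"] exI[of _ "\<lambda>p. ft p + gt p"])
       (auto intro: hc_ring.intros)
next
  case (hc_ring_mult f g)
  then obtain fx ft gx gt where *: "hc_ring \<kappa> C fx" "hc_ring \<kappa> C ft" "hc_ring \<kappa> C gx" "hc_ring \<kappa> C gt"
    "\<And>p. p \<in> S \<Longrightarrow> (f has_derivative (\<lambda>h. fx p * fst h + ft p * snd h)) (at p within S)"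
    "\<And>p. p \<in> S \<Longrightarrow> (g has_derivative (\<lambda>h. gx p * fst h + gt p * snd h)) (at p within S)"
    by blast
  have "((\<lambda>p. f p * g p) has_derivative
      (\<lambda>h. (f p * gx p + fx p * g p) * fst h + (f p * gt p + ft p * g p) * snd h))
      (at p within S)" if "p \<in> S" for p
    by (rule has_derivative_eq_rhs[OF has_derivative_mult[OF *(5,6)[OF that]]])
       (auto simp: fun_eq_iff algebra_simps)
  \<comment> \<open>The product rule also involves \<open>f\<close> and \<open>g\<close>
    undifferentiated, so their own membership is used.\<close>
  with *(1-4) hc_ring_mult.hyps show ?case
    by (intro exI[of _ "\<lambda>p. f p * gx p + fx p * g p"] exI[of _ "\<lambda>p. f p * gt p + ft p * g p"])
       (auto intro: hc_ring.intros)
qed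

text \<open>One factor \<kappa> from the inner derivative cancels the division by \<kappa>. The
  partial derivatives are written as explicit products, including \<open>- 1\<close>, so that the
  rules of \<open>hc_ring\<close> match them.\<close>

lemma has_derivative_pair_hairclip:
  fixes \<kappa> C :: real
  defines "u \<equiv> \<lambda>p. hc_cos \<kappa> C (fst p) (snd p)" and "v \<equiv> \<lambda>p. hc_sin \<kappa> C (fst p) (snd p)"
  assumes "\<kappa> \<noteq> 0"
  shows "((\<lambda>p. hairclip \<kappa> C (fst p) (snd p)) has_derivative
    (\<lambda>h. - 1 * (v p * (1 / sqrt (1 + (u p)\<^sup>2))) * fst h + - \<kappa> * (u p * (1 / sqrt (1 + (u p)\<^sup>2))) * snd h))
    (at p within S)"
proof -
  have "((\<lambda>y. arsinh y / \<kappa>) has_real_derivative 1 / sqrt (y\<^sup>2 + 1) / \<kappa>) (at y)" for y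
    using arsinh_real_has_field_derivative by (rule DERIV_cdivide)
  from DERIV_compose_FDERIV[OF this has_derivative_pair_hc_cos[of \<kappa> C]] show ?thesis
    unfolding hairclip_def u_def v_def
    by (rule has_derivative_eq_rhs)
       (use assms in \<open>auto simp: fun_eq_iff add_divide_distrib diff_divide_distrib power2_eq_square algebra_simps\<close>)
qed

lemma smooth_on_hairclip:
  assumes "\<kappa> \<noteq> 0"
  shows "smooth_on S (\<lambda>(x, t). hairclip \<kappa> C x t)"
  unfolding smooth_on_def case_prod_unfold
proof
  fix m
  \<comment> \<open>The \<open>arsinh\<close> is not a generator of the ring, so the solution itself
    is adjoined; its first partial derivatives already lie in the ring.\<close>
  define F where "F = (\<lambda>f. hc_ring \<kappa> C f \<or> f = (\<lambda>p. hairclip \<kappa> C (fst p) (snd p)))"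
  have "\<exists>fx ft. hc_ring \<kappa> C fx \<and> hc_ring \<kappa> C ft \<and>
      (\<forall>p\<in>S. ((\<lambda>p. hairclip \<kappa> C (fst p) (snd p)) has_derivative (\<lambda>h. fx p * fst h + ft p * snd h))
        (at p within S))"
    by (intro exI conjI ballI, rule_tac[3] has_derivative_pair_hairclip[OF assms])
       (intro hc_ring.intros)+
  then have closed: "\<exists>fx ft. F fx \<and> F ft \<and>
      (\<forall>p\<in>S. (f has_derivative (\<lambda>h. fx p * fst h + ft p * snd h)) (at p within S))" if "F f" for f
    using hc_ring_derivative_closed[of \<kappa> C f S] that unfolding F_def by blast
  show "Ck_on m S (\<lambda>p. hairclip \<kappa> C (fst p) (snd p))"
    by (rule Ck_on_derivative_closed[of F, OF closed]) (auto simp: F_def)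
qed

section \<open>The flow equation\<close>

lemma DERIV_hairclip_space:
  assumes "\<kappa> \<noteq> 0"
  shows "((\<lambda>x. hairclip \<kappa> C x t) has_real_derivative
    - hc_sin \<kappa> C x t / sqrt (1 + (hc_cos \<kappa> C x t)\<^sup>2)) (at x within A)"
  unfolding hairclip_def hc_cos_def hc_sin_def
  by (rule derivative_eq_intros refl arsinh_real_has_field_derivative[THEN DERIV_chain2])+
     (use assms in \<open>auto simp: field_simps\<close>)

lemma DERIV_hairclip_time:
  assumes "\<kappa> \<noteq> 0"
  shows "((\<lambda>s. hairclip \<kappa> C x s) has_real_derivative
    - \<kappa> * hc_cos \<kappa> C x t / sqrt (1 + (hc_cos \<kappa> C x t)\<^sup>2)) (at t within A)"
  unfolding hairclip_def hc_cos_def hc_sin_def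
  by (rule derivative_eq_intros refl arsinh_real_has_field_derivative[THEN DERIV_chain2])+
     (use assms in \<open>auto simp: field_simps power2_eq_square\<close>)

lemma dx_hairclip:
  assumes "\<kappa> \<noteq> 0"
  shows "dx (hairclip \<kappa> C) x t = - hc_sin \<kappa> C x t / sqrt (1 + (hc_cos \<kappa> C x t)\<^sup>2)"
  unfolding dx_def using DERIV_hairclip_space[OF assms] by (rule DERIV_imp_deriv)

text \<open>Over the common denominator, \<open>sin\<close> and \<open>cos\<close> combine by
  Pythagoras, so the numerator depends on \<open>t\<close> only.\<close>

lemma sqrt_one_plus_dx_hairclip:
  assumes "\<kappa> \<noteq> 0"
  shows "sqrt (1 + \<bar>dx (hairclip \<kappa> C) x t\<bar>\<^sup>2)
    = sqrt (1 + (C * exp (- \<kappa>\<^sup>2 * t))\<^sup>2) / sqrt (1 + (hc_cos \<kappa> C x t)\<^sup>2)"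
proof -
  have "(hc_cos \<kappa> C x t)\<^sup>2 + (hc_sin \<kappa> C x t)\<^sup>2 = (C * exp (- \<kappa>\<^sup>2 * t))\<^sup>2"
    unfolding hc_cos_def hc_sin_def power_mult_distrib
    by (metis distrib_left mult.right_neutral sin_cos_squared_add2)
  moreover have "1 + (hc_cos \<kappa> C x t)\<^sup>2 > 0"
    by (simp add: add_pos_nonneg)
  ultimately have "1 + \<bar>dx (hairclip \<kappa> C) x t\<bar>\<^sup>2
      = (1 + (C * exp (- \<kappa>\<^sup>2 * t))\<^sup>2) / (1 + (hc_cos \<kappa> C x t)\<^sup>2)"
    unfolding dx_hairclip[OF assms] by (simp add: power_divide field_simps)
  then show ?thesis
    by (simp add: real_sqrt_divide)
qed

text \<open>The quotient under the outer derivative reduces to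
  \<open>- hc_sin \<kappa> C y t / b\<close> with \<open>b\<close> constant in space, so
  differentiating it is elementary. The factor \<open>b\<close> in the arc length element then
  cancels and leaves the time derivative.\<close>

lemma graph_mcf_solution_hairclip:
  assumes "\<kappa> \<noteq> 0"
  shows "graph_mcf_solution (hairclip \<kappa> C)"
  unfolding graph_mcf_solution_def
proof (intro conjI allI impI)
  show "smooth_on (UNIV \<times> {0..}) (\<lambda>(x, t). hairclip \<kappa> C x t)"
    using assms by (rule smooth_on_hairclip)
next
  fix x t :: real
  define b where "b = sqrt (1 + (C * exp (- \<kappa>\<^sup>2 * t))\<^sup>2)"
  have b: "b > 0"
    unfolding b_def by (rule sqrt_one_plus_square_pos)
  have "dx (hairclip \<kappa> C) y t / sqrt (1 + \<bar>dx (hairclip \<kappa> C) y t\<bar>\<^sup>2) = - hc_sin \<kappa> C y t / b" for y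
    using sqrt_one_plus_square_pos[of "hc_cos \<kappa> C y t"]
    unfolding sqrt_one_plus_dx_hairclip[OF assms] unfolding dx_hairclip[OF assms] b_def[symmetric]
    by (simp add: field_simps)
  moreover have "((\<lambda>y. - hc_sin \<kappa> C y t / b) has_real_derivative - \<kappa> * hc_cos \<kappa> C x t / b) (at x)"
    unfolding hc_sin_def hc_cos_def
    using b by (auto intro!: derivative_eq_intros simp: field_simps)
  ultimately have "deriv (\<lambda>y. dx (hairclip \<kappa> C) y t / sqrt (1 + \<bar>dx (hairclip \<kappa> C) y t\<bar>\<^sup>2)) x
      = - \<kappa> * hc_cos \<kappa> C x t / b"
    by (simp add: DERIV_imp_deriv)
  then have "sqrt (1 + \<bar>dx (hairclip \<kappa> C) x t\<bar>\<^sup>2) *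
        deriv (\<lambda>y. dx (hairclip \<kappa> C) y t / sqrt (1 + \<bar>dx (hairclip \<kappa> C) y t\<bar>\<^sup>2)) x
      = - \<kappa> * hc_cos \<kappa> C x t / sqrt (1 + (hc_cos \<kappa> C x t)\<^sup>2)"
    unfolding sqrt_one_plus_dx_hairclip[OF assms] b_def[symmetric] using b by simp
  then show "((\<lambda>s. hairclip \<kappa> C x s) has_real_derivative
      sqrt (1 + \<bar>dx (hairclip \<kappa> C) x t\<bar>\<^sup>2) *
      deriv (\<lambda>y. dx (hairclip \<kappa> C) y t / sqrt (1 + \<bar>dx (hairclip \<kappa> C) y t\<bar>\<^sup>2)) x) (at t within {0..})"
    using DERIV_hairclip_time[OF assms] by simp
qed

section \<open>Sup norm at time \<open>0\<close>\<close>

lemma arsinh_le_iff_real [simp]: "arsinh x \<le> arsinh y \<longleftrightarrow> x \<le> (y::real)"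
  by (meson arsinh_less_iff_real not_le)

lemma arsinh_real_nonneg_iff [simp]: "arsinh x \<ge> 0 \<longleftrightarrow> x \<ge> (0::real)"
  by (meson arsinh_real_neg_iff not_le)

text \<open>As \<open>arsinh\<close> is odd and increasing, the bound follows from that on the
  cosine; it is attained at \<open>x = 0\<close>.\<close>

lemma sup_norm_hairclip_0:
  assumes "\<kappa> > 0" "C \<ge> 0"
  shows "sup_norm (\<lambda>x. hairclip \<kappa> C x 0) = ereal (arsinh C / \<kappa>)"
  unfolding sup_norm_def
proof (rule antisym)
  show "(SUP x. ereal \<bar>hairclip \<kappa> C x 0\<bar>) \<le> ereal (arsinh C / \<kappa>)"
  proof (rule SUP_least)
    fix x
    have "\<bar>C * cos (\<kappa> * x)\<bar> \<le> C"
      using assms mult_left_le[of "\<bar>cos (\<kappa> * x)\<bar>" C] by (simp add: abs_mult)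
    then have "arsinh (C * cos (\<kappa> * x)) \<le> arsinh C" "arsinh (- C) \<le> arsinh (C * cos (\<kappa> * x))"
      unfolding arsinh_le_iff_real by auto
    then have "\<bar>arsinh (C * cos (\<kappa> * x))\<bar> \<le> arsinh C"
      by (simp add: abs_le_iff)
    then show "ereal \<bar>hairclip \<kappa> C x 0\<bar> \<le> ereal (arsinh C / \<kappa>)"
      using assms by (simp add: hairclip_def hc_cos_def abs_divide divide_right_mono)
  qed
  have "ereal (arsinh C / \<kappa>) = ereal \<bar>hairclip \<kappa> C 0 0\<bar>"
    using assms by (simp add: hairclip_def hc_cos_def)
  also have "\<dots> \<le> (SUP x. ereal \<bar>hairclip \<kappa> C x 0\<bar>)"
    by (rule SUP_upper) simp
  finally show "ereal (arsinh C / \<kappa>) \<le> (SUP x. ereal \<bar>hairclip \<kappa> C x 0\<bar>)" .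
qed

section \<open>Lower bounds for arc length\<close>

text \<open>The integrand dominates the absolute value of \<open>f'\<close>, whose integral is the
  height difference.\<close>

lemma arc_length_ge_height:
  fixes f f' :: "real \<Rightarrow> real"
  assumes "a \<le> b" "\<And>x. (f has_real_derivative f' x) (at x)"
    and "(\<lambda>x. sqrt (1 + \<bar>f' x\<bar>\<^sup>2)) integrable_on {a..b}"
  shows "\<bar>f b - f a\<bar> \<le> integral {a..b} (\<lambda>x. sqrt (1 + \<bar>f' x\<bar>\<^sup>2))"
proof -
  have f': "(f' has_integral (f b - f a)) {a..b}"
    using assms by (intro fundamental_theorem_of_calculus)
      (auto simp: has_real_derivative_iff_has_vector_derivative[symmetric] intro: DERIV_subset)
  have "norm (integral {a..b} f') \<le> integral {a..b} (\<lambda>x. sqrt (1 + \<bar>f' x\<bar>\<^sup>2))"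
    using f' assms(3) by (intro integral_norm_bound_integral) (auto intro!: real_le_rsqrt)
  then show ?thesis
    using f' by (simp add: integral_unique)
qed

lemma arc_length_ge_sum_heights:
  fixes f f' :: "real \<Rightarrow> real"
  assumes h: "h \<ge> 0" and der: "\<And>x. (f has_real_derivative f' x) (at x)"
    and cont: "continuous_on UNIV f'"
  shows "(\<Sum>i<n. \<bar>f (a + real (Suc i) * h) - f (a + real i * h)\<bar>)
    \<le> integral {a..a + real n * h} (\<lambda>x. sqrt (1 + \<bar>f' x\<bar>\<^sup>2))"
proof (induction n)
  case (Suc n)
  have int: "(\<lambda>x. sqrt (1 + \<bar>f' x\<bar>\<^sup>2)) integrable_on {c..d}" for c d
    by (intro integrable_continuous_interval continuous_intros continuous_on_subset[OF cont]) auto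
  have le: "a \<le> a + real n * h" "a + real n * h \<le> a + real (Suc n) * h"
    using h by (auto simp: algebra_simps)
  have "\<bar>f (a + real (Suc n) * h) - f (a + real n * h)\<bar>
      \<le> integral {a + real n * h..a + real (Suc n) * h} (\<lambda>x. sqrt (1 + \<bar>f' x\<bar>\<^sup>2))"
    by (rule arc_length_ge_height[OF le(2) der int])
  then show ?case
    using Suc.IH Henstock_Kurzweil_Integration.integral_combine[OF le int] by simp
qed simp

text \<open>The points \<open>- pi + i * pi / k\<close> are consecutive extrema of
  \<open>cos (k * x)\<close>, with alternating signs. Each of the \<open>2 * k\<close> intervals
  between them contributes twice the amplitude \<open>?A / k\<close>, which sums to
  \<open>4 * ?A\<close>.\<close>

lemma arc_length_hairclip_ge:
  fixes k :: nat and C :: real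
  assumes "k > 0" "C \<ge> 0"
  shows "4 * arsinh (C * exp (- (real k)\<^sup>2 * t))
    \<le> integral {-pi..pi} (\<lambda>x. sqrt (1 + \<bar>dx (hairclip (real k) C) x t\<bar>\<^sup>2))"
proof -
  let ?w = "\<lambda>x. hairclip (real k) C x t"
  let ?A = "arsinh (C * exp (- (real k)\<^sup>2 * t))"
  have k: "real k \<noteq> 0"
    using assms by simp
  have A: "?A \<ge> 0"
    using assms by simp
  have w: "?w (- pi + real i * (pi / real k)) = (- 1) ^ (k + i) * (?A / real k)" for i
  proof -
    have "real k * (- pi + real i * (pi / real k)) = real i * pi - real k * pi"
      using k by (simp add: field_simps)
    then have "cos (real k * (- pi + real i * (pi / real k))) = (- 1) ^ (k + i)"
      by (simp add: cos_diff power_add)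
    then show ?thesis
      by (cases "even (k + i)") (simp_all add: hairclip_def hc_cos_def)
  qed
  have der: "(?w has_real_derivative dx (hairclip (real k) C) x t) (at x)" for x
    unfolding dx_hairclip[OF k] by (rule DERIV_hairclip_space[OF k])
  have cont: "continuous_on UNIV (\<lambda>x. dx (hairclip (real k) C) x t)"
    unfolding dx_hairclip[OF k] hc_sin_def hc_cos_def
    by (intro continuous_intros) (auto simp: add_nonneg_eq_0_iff)
  have "\<bar>?w (- pi + real (Suc i) * (pi / real k)) - ?w (- pi + real i * (pi / real k))\<bar>
      = 2 * (?A / real k)" for i
    unfolding w using A by (cases "even (k + i)") (simp_all del: arsinh_real_nonneg_iff)
  then have "(\<Sum>i<2 * k. \<bar>?w (- pi + real (Suc i) * (pi / real k)) - ?w (- pi + real i * (pi / real k))\<bar>)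
      = 4 * ?A"
    using k by simp
  with arc_length_ge_sum_heights[OF _ der cont, where h="pi / real k" and n="2 * k" and a="- pi"] k show ?thesis
    by simp
qed

theorem proposition3:
  fixes k :: int
  assumes "k > 1"
  shows "\<exists>w :: real \<Rightarrow> real \<Rightarrow> real.
    graph_mcf_solution w \<and>
    ereal (2 * real_of_int k) < sup_norm (\<lambda>x. w x 0) \<and>
    sup_norm (\<lambda>x. w x 0) \<le> ereal (3 * real_of_int k) \<and>
    4 * (real_of_int k)\<^sup>2 - 2 * real_of_int k
      \<le> integral {-pi..pi} (\<lambda>x. sqrt (1 + \<bar>dx w x 1\<bar>\<^sup>2))"
proof -
  define n where "n = nat k"
  have n: "real_of_int k = real n" "n > 0"
    using assms by (auto simp: n_def)
  \<comment> \<open>Chosen so that \<open>arsinh C / n\<close> is exactly \<open>3 * n\<close>, the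
    largest sup norm allowed.\<close>
  define C where "C = sinh (3 * (real n)\<^sup>2)"
  have C: "C \<ge> 0"
    by (simp add: C_def)
  have sup: "sup_norm (\<lambda>x. hairclip (real n) C x 0) = ereal (3 * real n)"
    using sup_norm_hairclip_0[of "real n" C] n C
    by (simp add: C_def arsinh_sinh_real power2_eq_square)
  have "C * exp (- (real n)\<^sup>2 * 1) = (exp (2 * (real n)\<^sup>2) - exp (- (4 * (real n)\<^sup>2))) / 2"
    by (simp add: C_def sinh_def field_simps exp_add[symmetric])
  also have "\<dots> \<ge> (exp ((real n)\<^sup>2) - exp (- (real n)\<^sup>2)) / 2"
    \<comment> \<open>Lowering the exponent \<open>2 * n\<^sup>2\<close> to \<open>n\<^sup>2\<close>
      and raising \<open>- 4 * n\<^sup>2\<close> to \<open>- n\<^sup>2\<close> only decreases the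
      difference, and turns it into a \<open>sinh\<close> that \<open>arsinh\<close>
      inverts.\<close>
    by (intro divide_right_mono diff_mono) auto
  finally have "sinh ((real n)\<^sup>2) \<le> C * exp (- (real n)\<^sup>2 * 1)"
    by (simp add: sinh_def)
  then have "arsinh (sinh ((real n)\<^sup>2)) \<le> arsinh (C * exp (- (real n)\<^sup>2 * 1))"
    by (simp only: arsinh_le_iff_real)
  then have "4 * (real n)\<^sup>2 \<le> 4 * arsinh (C * exp (- (real n)\<^sup>2 * 1))"
    by (simp add: arsinh_sinh_real)
  also have "\<dots> \<le> integral {-pi..pi} (\<lambda>x. sqrt (1 + \<bar>dx (hairclip (real n) C) x 1\<bar>\<^sup>2))"
    by (rule arc_length_hairclip_ge[OF n(2) C])
  finally have "4 * (real n)\<^sup>2 - 2 * real n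
      \<le> integral {-pi..pi} (\<lambda>x. sqrt (1 + \<bar>dx (hairclip (real n) C) x 1\<bar>\<^sup>2))"
    by simp
  then show ?thesis
    using sup n graph_mcf_solution_hairclip[of "real n" C]
    by (intro exI[of _ "hairclip (real n) C"]) auto
qed

end
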